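(* Let $X$ be an infinite-dimensional complex Banach space, let $T\in\mathcal{B}(X)$ and let $M$ be a paracomplete subspace of $X$ such that $M+\mathcal{R}(T)$ is topologically complemented in $X$. If $T^{-1}(M)$ is topologically complemented in $X$, then $M$ is also topologically complemented in $X$.
   Context: $\mathcal{B}(X)$ is the algebra of bounded linear operators on $X$; $\mathcal{R}(T)$ denotes the range of $T$ and $T^{-1}(M)=\{x\in X: Tx\in M\}$. A subspace of $X$ is paracomplete if it is the range of a bounded linear operator (from some Banach space into $X$). A subspace of $X$ is topologically complemented if it is closed and has a closed algebraic complement in $X$. *)

theory Defs
  imports "HOL-Analysis.Analysis" "HOL-Library.Set_Algebras"
begin

text \<open>Complex normed spaces extend the library's real normed spaces by a complex scalar
  multiplication that restricts to the given real one.\<close>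

class complex_normed_vector = real_normed_vector +
  fixes scaleC :: "complex \<Rightarrow> 'a \<Rightarrow> 'a" (infixr \<open>*\<^sub>C\<close> 75)
  assumes scaleC_add_right: "c *\<^sub>C (x + y) = c *\<^sub>C x + c *\<^sub>C y"
    and scaleC_add_left: "(c + d) *\<^sub>C x = c *\<^sub>C x + d *\<^sub>C x"
    and scaleC_scaleC: "c *\<^sub>C d *\<^sub>C x = (c * d) *\<^sub>C x"
    and scaleC_of_real: "complex_of_real r *\<^sub>C x = r *\<^sub>R x"
    and norm_scaleC: "norm (c *\<^sub>C x) = norm c * norm x"

class complex_banach = complex_normed_vector + banach

global_interpretation complex_vector:
  vector_space "scaleC :: complex \<Rightarrow> 'a \<Rightarrow> 'a::complex_normed_vector"
proof
  show "1 *\<^sub>C x = x" for x :: 'a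
    using scaleC_of_real[of 1 x] by simp
qed (simp_all add: scaleC_add_right scaleC_add_left scaleC_scaleC)

instantiation complex :: complex_banach
begin

definition scaleC_complex :: "complex \<Rightarrow> complex \<Rightarrow> complex"
  where "scaleC_complex c x = c * x"

instance
  by standard (simp_all add: scaleC_complex_def algebra_simps norm_mult scaleR_conv_of_real)

end

definition infinite_dimensional :: "'a::complex_normed_vector itself \<Rightarrow> bool"
  where "infinite_dimensional _ \<longleftrightarrow>
    \<not> (\<exists>B :: 'a set. finite B \<and> complex_vector.span B = UNIV)"

definition bounded_clinear ::
    "('a::complex_normed_vector \<Rightarrow> 'b::complex_normed_vector) \<Rightarrow> bool"
  where "bounded_clinear f \<longleftrightarrow>
    bounded_linear f \<and> (\<forall>c x. f (c *\<^sub>C x) = c *\<^sub>C f x)"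

text \<open>HOL cannot quantify existentially over the Banach space on which the operator is defined, so
  that space is the type argument. A theorem assuming \<open>paracomplete TYPE('b) M\<close> with \<open>'b\<close> a free
  type variable holds for every choice of the space.\<close>

definition paracomplete ::
    "'b::complex_banach itself \<Rightarrow> 'a::complex_normed_vector set \<Rightarrow> bool"
  where "paracomplete _ M \<longleftrightarrow>
    (\<exists>S :: 'b \<Rightarrow> 'a. bounded_clinear S \<and> M = range S)"

text \<open>The sum of sets below is the elementwise sum from \<^theory>\<open>HOL-Library.Set_Algebras\<close>.\<close>

definition topologically_complemented :: "'a::complex_normed_vector set \<Rightarrow> bool"
  where "topologically_complemented M \<longleftrightarrow>
    complex_vector.subspace M \<and> closed M \<and>
    (\<exists>N. complex_vector.subspace N \<and> closed N \<and> M \<inter> N = {0} \<and> M + N = UNIV)"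

end

theory Submission imports Defs begin

text \<open>Let \<open>N\<close> be a closed complement of \<open>T -` M\<close> and \<open>L\<close> a closed complement of \<open>M + range T\<close>. Since
  \<open>N\<close> meets \<open>T -` M\<close> trivially, \<open>T ` N\<close> meets \<open>M\<close> trivially; since \<open>N\<close> and \<open>T -` M\<close> span the space,
  \<open>M + T ` N = M + range T\<close>. Hence the space is the algebraic direct sum of \<open>M\<close> and
  \<open>T ` N + L\<close>.

  Neither summand is visibly closed, but both are images of closed subspaces of Banach spaces
  under bounded operators: \<open>M\<close> because it is paracomplete, and \<open>T ` N + L\<close> as the image of
  \<open>N \<times> L\<close> under \<open>(n, l) \<mapsto> T n + l\<close>. Two such subspaces that are algebraic complements of each
  other are closed (\<open>closed_range_of_complementary_ranges\<close>): by the open mapping theorem, every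
  vector splits into its two components with control of the norms, so the algebraic projections
  are bounded. The open mapping theorem is proved in the quantitative form that is used there, from
  the Baire category theorem.\<close>

section \<open>The open mapping theorem on a closed subspace\<close>

text \<open>The Baire half of the open mapping theorem. The closures of the images of the balls of
  radius \<open>n\<close> cover the target, so one of them contains a ball around some \<open>y0\<close>. Taking
  differences moves that ball to the origin, and homogeneity spreads the approximate solvability
  to every right-hand side.\<close>

lemma bounded_approximate_preimages:
  fixes f :: "'c::real_normed_vector \<Rightarrow> 'd::banach"
  assumes f: "linear f" and D: "subspace D" and onto: "f ` D = UNIV"
  obtains K where "K \<ge> 0"
    "\<And>y e. e > 0 \<Longrightarrow> \<exists>x\<in>D. norm x \<le> K * norm y \<and> norm (y - f x) < e"
proof -
  let ?F = "\<lambda>n::nat. closure (f ` (D \<inter> cball 0 (real n)))"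
  have "(\<Union>n. ?F n) = UNIV"
  proof -
    have "y \<in> (\<Union>n. ?F n)" for y
    proof -
      obtain x where x: "x \<in> D" "y = f x" using onto by blast
      obtain n where "norm x \<le> real n" using real_arch_simple by blast
      then have "y \<in> f ` (D \<inter> cball 0 (real n))" using x by auto
      then have "y \<in> ?F n" by (rule subsetD[OF closure_subset])
      then show ?thesis by (rule UN_I[OF UNIV_I])
    qed
    then show ?thesis by blast
  qed
  moreover have "euclidean interior_of \<Union>(range ?F) = {}" if "\<And>n. interior (?F n) = {}"
    by (rule Baire_category_alt) (use that in \<open>auto simp: completely_metrizable_space_euclidean\<close>)
  ultimately obtain n y0 where "y0 \<in> interior (?F n)"
    by fastforce
  then obtain r where r: "r > 0" and sub: "cball y0 r \<subseteq> ?F n"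
    by (auto simp: mem_interior_cball)
  define K where "K = 2 * real n / r"
  show thesis
  proof
    show "K \<ge> 0" using r by (simp add: K_def)
    fix y :: 'd and e :: real assume e: "e > 0"
    show "\<exists>x\<in>D. norm x \<le> K * norm y \<and> norm (y - f x) < e"
    proof (cases "y = 0")
      case True
      then show ?thesis using D e linear_0[OF f] subspace_0[OF D] by force
    next
      case False
      define s where "s = norm y / r"
      have s: "s > 0" using False r by (simp add: s_def)
      define d where "d = e / (2 * s)"
      have d: "d > 0" using e s by (simp add: d_def)
      define z where "z = (1 / s) *\<^sub>R y"
      have y: "y = s *\<^sub>R z" using s by (simp add: z_def)
      have "norm z = r" using s r False by (simp add: z_def s_def)
      then have "y0 + z \<in> ?F n" "y0 \<in> ?F n"
        using sub r by (auto simp: dist_norm)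
      then obtain x1 x2 where x: "x1 \<in> D" "norm x1 \<le> n" "dist (f x1) (y0 + z) < d"
          "x2 \<in> D" "norm x2 \<le> n" "dist (f x2) y0 < d"
        using d unfolding closure_approachable by force
      define x where "x = s *\<^sub>R (x1 - x2)"
      have "x \<in> D" using x D by (simp add: x_def subspace_scale subspace_diff)
      moreover have "norm x \<le> K * norm y"
      proof -
        have "norm (x1 - x2) \<le> 2 * real n"
          using norm_triangle_ineq4[of x1 x2] x by linarith
        then have "norm x \<le> s * (2 * real n)" using s by (simp add: x_def)
        then show ?thesis by (simp add: K_def s_def mult.commute)
      qed
      moreover have "norm (y - f x) < e"
      proof -
        have "y - f x = s *\<^sub>R ((f x2 - y0) - (f x1 - (y0 + z)))"
          by (simp add: y x_def linear_scale[OF f] linear_diff[OF f] algebra_simps)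
        also have "norm \<dots> = s * norm ((f x2 - y0) - (f x1 - (y0 + z)))"
          using s by simp
        also have "\<dots> < s * (2 * d)"
          using norm_triangle_ineq4[of "f x2 - y0" "f x1 - (y0 + z)"] x s
          by (intro mult_strict_left_mono) (auto simp: dist_norm)
        also have "\<dots> = e" using s by (simp add: d_def)
        finally show ?thesis .
      qed
      ultimately show ?thesis by blast
    qed
  qed
qed

text \<open>Approximate solutions become exact by successive correction: solving for the remaining
  error, which halves at every step, gives a series that converges absolutely in the closed set
  \<open>D\<close> and whose sum is at most twice the first bound.\<close>

lemma open_mapping_closed_subspace:
  fixes f :: "'c::banach \<Rightarrow> 'd::banach"
  assumes f: "bounded_linear f" and D: "subspace D" "closed D" and onto: "f ` D = UNIV"
  obtains C where "C \<ge> 0" "\<And>y. \<exists>x\<in>D. f x = y \<and> norm x \<le> C * norm y"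
proof -
  interpret f: bounded_linear f by fact
  obtain K where K: "K \<ge> 0"
    and approx: "\<And>y e. e > 0 \<Longrightarrow> \<exists>x\<in>D. norm x \<le> K * norm y \<and> norm (y - f x) < e"
    using bounded_approximate_preimages[OF f.linear_axioms D(1) onto] by metis
  have "\<exists>x\<in>D. norm x \<le> K * norm y \<and> norm (y - f x) \<le> norm y / 2" for y
  proof (cases "y = 0")
    case True
    then show ?thesis using subspace_0[OF D(1)] f.zero by force
  next
    case False
    then show ?thesis using approx[of "norm y / 2" y] by force
  qed
  then obtain g where g: "\<And>y. g y \<in> D" "\<And>y. norm (g y) \<le> K * norm y"
      "\<And>y. norm (y - f (g y)) \<le> norm y / 2"
    by metis
  show thesis
  proof
    show "2 * K \<ge> 0" using K by simp
    fix y
    \<comment> \<open>\<open>e n\<close> is the error that is left after \<open>n\<close> corrections.\<close>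
    define e where "e n = ((\<lambda>z. z - f (g z)) ^^ n) y" for n
    have e_0: "e 0 = y" and e_Suc: "e (Suc n) = e n - f (g (e n))" for n
      by (simp_all add: e_def)
    have e_le: "norm (e n) \<le> norm y * (1/2) ^ n" for n
    proof (induction n)
      case (Suc n)
      then show ?case using g(3)[of "e n"] by (simp add: e_Suc)
    qed (simp add: e_0)
    have term_le: "norm (g (e n)) \<le> K * norm y * (1/2) ^ n" for n
      using g(2)[of "e n"] mult_left_mono[OF e_le[of n] K] by (simp add: mult.assoc)
    have geometric: "(\<lambda>n. K * norm y * (1/2) ^ n) sums (2 * K * norm y)"
      using sums_mult[OF geometric_sums[of "1/2::real"], of "K * norm y"] by (simp add: mult_ac)
    define x where "x = (\<Sum>n. g (e n))"
    have sums: "(\<lambda>n. g (e n)) sums x"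
      unfolding x_def using summable_comparison_test'[OF sums_summable[OF geometric] term_le]
      by (rule summable_sums)
    have "x \<in> D"
    proof (rule closed_sequentially[OF D(2)])
      show "(\<lambda>n. \<Sum>i<n. g (e i)) \<longlonglongrightarrow> x" using sums by (simp add: sums_def)
    qed (intro subspace_sum[OF D(1)] g(1))
    moreover have "f x = y"
    proof -
      have "(\<Sum>i<n. f (g (e i))) = y - e n" for n
        by (induction n) (simp_all add: e_0 e_Suc)
      moreover have "e \<longlonglongrightarrow> 0"
      proof (rule Lim_null_comparison)
        show "(\<lambda>n. norm y * (1/2) ^ n) \<longlonglongrightarrow> 0"
          using tendsto_mult_right_zero[OF LIMSEQ_power_zero[of "1/2::real"]] by simp
      qed (use e_le in auto)
      ultimately have "(\<lambda>n. f (g (e n))) sums y"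
        unfolding sums_def by (auto intro: tendsto_eq_intros)
      with f.sums[OF sums] show ?thesis by (rule sums_unique2)
    qed
    moreover have "norm x \<le> 2 * K * norm y"
      unfolding x_def sums_unique[OF geometric]
      by (rule norm_suminf_le) (use term_le sums_summable[OF geometric] in auto)
    ultimately show "\<exists>x\<in>D. f x = y \<and> norm x \<le> 2 * K * norm y" by blast
  qed
qed

section \<open>Complementary operator ranges\<close>

text \<open>The open mapping theorem applies to \<open>(a, b) \<mapsto> S a + R b\<close>. The preimages \<open>a\<close> and \<open>b\<close> of a vector
  need not be unique, but its components \<open>S a\<close> and \<open>R b\<close> are, because the two ranges meet only in
  zero. So the component in \<open>R ` B\<close> depends boundedly on the vector; it vanishes on \<open>S ` A\<close>,
  hence on the closure of \<open>S ` A\<close>.\<close>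

lemma closed_range_of_complementary_ranges:
  fixes S :: "'b::banach \<Rightarrow> 'a::banach" and R :: "'c::banach \<Rightarrow> 'a"
  assumes S: "bounded_linear S" and A: "subspace A" "closed A"
    and R: "bounded_linear R" and B: "subspace B" "closed B"
    and disj: "S ` A \<inter> R ` B \<subseteq> {0}" and sum: "S ` A + R ` B = UNIV"
  shows "closed (S ` A)"
proof -
  interpret S: bounded_linear S by fact
  interpret R: bounded_linear R by fact
  let ?f = "\<lambda>p. S (fst p) + R (snd p)"
  have f: "bounded_linear ?f"
    by (intro bounded_linear_add bounded_linear_compose[OF S] bounded_linear_compose[OF R]
        bounded_linear_fst bounded_linear_snd)
  have onto: "?f ` (A \<times> B) = UNIV"
    using sum by (force elim!: set_plus_elim)
  obtain C where C: "C \<ge> 0"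
    and split: "\<And>y. \<exists>p\<in>A \<times> B. ?f p = y \<and> norm p \<le> C * norm y"
    using open_mapping_closed_subspace[OF f subspace_Times[OF A(1) B(1)]
        closed_Times[OF A(2) B(2)] onto] by metis
  obtain k where k: "k > 0" "\<And>b. norm (R b) \<le> norm b * k"
    using R.pos_bounded by blast
  have component_le: "norm (R b) \<le> k * C * norm (S a + R b)" if "a \<in> A" "b \<in> B" for a b
  proof -
    obtain a' b' where ab: "a' \<in> A" "b' \<in> B" "S a' + R b' = S a + R b"
        "norm (a', b') \<le> C * norm (S a + R b)"
      using split[of "S a + R b"] by auto
    have "S (a' - a) = R (b - b')"
      using ab(3) by (simp add: S.diff R.diff algebra_simps)
    moreover have "a' - a \<in> A" "b - b' \<in> B"
      using that ab A B by (auto intro: subspace_diff)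
    ultimately have "R (b - b') = 0" using disj by (metis IntI image_eqI singletonD subsetD)
    then have "norm (R b) = norm (R b')" by (simp add: R.diff)
    also have "\<dots> \<le> norm b' * k" by (rule k)
    also have "\<dots> \<le> C * norm (S a + R b) * k"
      using norm_snd_le[of b' a'] ab(4) k(1) by (intro mult_right_mono) auto
    finally show ?thesis by (simp add: mult_ac)
  qed
  have "x \<in> S ` A" if x: "x \<in> closure (S ` A)" for x
  proof -
    have "x \<in> S ` A + R ` B" using sum by simp
    then obtain a b where ab: "a \<in> A" "b \<in> B" "x = S a + R b"
      by (blast elim: set_plus_elim)
    have "norm (R b) \<le> 0"
    proof (rule field_le_epsilon)
      fix e :: real assume e: "e > 0"
      have kC: "k * C + 1 > 0" using k C by (simp add: add_nonneg_pos)
      then obtain c where c: "c \<in> A" "norm (x - S c) < e / (k * C + 1)"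
        using closure_approachableD[OF x, of "e / (k * C + 1)"] e by (auto simp: dist_norm)
      have "norm (R b) \<le> k * C * norm (x - S c)"
        using component_le[of "a - c" b] ab c A by (simp add: S.diff subspace_diff algebra_simps)
      also have "\<dots> \<le> (k * C + 1) * norm (x - S c)" by (simp add: distrib_right)
      also have "\<dots> \<le> e" using c(2) kC by (simp add: field_simps)
      finally show "norm (R b) \<le> 0 + e" by simp
    qed
    then show ?thesis using ab by simp
  qed
  then show ?thesis by (metis closure_subset closure_eq subsetI subset_antisym)
qed

section \<open>Topologically complemented subspaces\<close>

lemma subspace_if_complex_subspace:
  assumes "complex_vector.subspace V"
  shows "subspace V"
  using assms unfolding complex_vector.subspace_def subspace_def
  by (metis scaleC_of_real)

theorem lemma3p4:
  fixes T :: "'a::complex_banach \<Rightarrow> 'a" and M :: "'a set"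
  assumes "infinite_dimensional TYPE('a)"
    and "bounded_clinear T"
    and "paracomplete TYPE('b::complex_banach) M"
    and "topologically_complemented (M + range T)"
    and "topologically_complemented (T -` M)"
  shows "topologically_complemented M"
proof -
  have T: "bounded_linear T" and T_scaleC: "\<And>c x. T (c *\<^sub>C x) = c *\<^sub>C T x"
    using assms(2) by (auto simp: bounded_clinear_def)
  interpret T: bounded_linear T by fact
  obtain S :: "'b \<Rightarrow> 'a" where S: "bounded_linear S" "\<And>c x. S (c *\<^sub>C x) = c *\<^sub>C S x"
    and M: "M = range S"
    using assms(3) by (auto simp: paracomplete_def bounded_clinear_def)
  interpret S: bounded_linear S by fact
  obtain L where L: "complex_vector.subspace L" "closed L"
    and sumL: "(M + range T) \<inter> L = {0}" "M + range T + L = UNIV"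
    using assms(4) by (auto simp: topologically_complemented_def)
  obtain N where N: "complex_vector.subspace N" "closed N"
    and preN: "T -` M \<inter> N = {0}" "T -` M + N = UNIV"
    using assms(5) by (auto simp: topologically_complemented_def)
  have subM: "complex_vector.subspace M"
    unfolding complex_vector.subspace_def M
    by (auto simp flip: S.add S(2) intro: range_eqI[of _ _ 0] simp: S.zero)
  define R where "R p = T (fst p) + snd p" for p :: "'a \<times> 'a"
  define W where "W = R ` (N \<times> L)"
  have R: "bounded_linear R"
    unfolding R_def
    by (intro bounded_linear_add bounded_linear_compose[OF T] bounded_linear_fst bounded_linear_snd)
  have subW: "complex_vector.subspace W"
  proof -
    have "T n + l + (T n' + l') \<in> W" if "n \<in> N" "n' \<in> N" "l \<in> L" "l' \<in> L" for n n' l l'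
      unfolding W_def
      by (rule image_eqI[of _ _ "(n + n', l + l')"])
        (use that N(1) L(1) in \<open>auto simp: R_def T.add complex_vector.subspace_add\<close>)
    moreover have "c *\<^sub>C (T n + l) \<in> W" if "n \<in> N" "l \<in> L" for c n l
      unfolding W_def
      by (rule image_eqI[of _ _ "(c *\<^sub>C n, c *\<^sub>C l)"])
        (use that N(1) L(1) in
          \<open>auto simp: R_def T_scaleC scaleC_add_right complex_vector.subspace_scale\<close>)
    moreover have "0 \<in> W"
      unfolding W_def
      by (rule image_eqI[of _ _ "(0, 0)"])
        (use N(1) L(1) in \<open>auto simp: R_def T.zero complex_vector.subspace_0\<close>)
    ultimately show ?thesis
      unfolding complex_vector.subspace_def by (auto simp: W_def R_def)
  qed
  have disj: "M \<inter> W = {0}"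
  proof -
    have "T n + l = 0" if m: "T n + l \<in> M" and nl: "n \<in> N" "l \<in> L" for n l
    proof -
      have "l = (T n + l) + T (- n)" by (simp add: T.neg)
      then have "l \<in> M + range T" using m by (metis rangeI set_plus_intro)
      then have l: "l = 0" using nl sumL(1) by blast
      then have "n \<in> T -` M \<inter> N" using m nl by simp
      then show ?thesis using l preN(1) T.zero by simp
    qed
    moreover have "0 \<in> M" "0 \<in> W"
      using subM subW by (auto simp: complex_vector.subspace_0)
    ultimately show ?thesis by (auto simp: W_def R_def)
  qed
  have sum: "M + W = UNIV"
  proof -
    have "x \<in> M + W" for x
    proof -
      have "x \<in> M + range T + L" using sumL(2) by simp
      then obtain m z l where x: "x = m + T z + l" "m \<in> M" "l \<in> L"
        by (blast elim: set_plus_elim)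
      have "z \<in> T -` M + N" using preN(2) by simp
      then obtain v n where z: "z = v + n" "T v \<in> M" "n \<in> N"
        by (blast elim: set_plus_elim)
      have "x = (m + T v) + R (n, l)" by (simp add: x z R_def T.add add_ac)
      moreover have "m + T v \<in> M" using subM x z by (simp add: complex_vector.subspace_add)
      moreover have "R (n, l) \<in> W" using x z by (simp add: W_def)
      ultimately show ?thesis by (metis set_plus_intro)
    qed
    then show ?thesis by blast
  qed
  have NL: "subspace (N \<times> L)" "closed (N \<times> L)"
    using N L by (simp_all add: subspace_Times subspace_if_complex_subspace closed_Times)
  have "closed M"
    unfolding M
    by (rule closed_range_of_complementary_ranges[OF S(1) _ _ R NL])
      (use disj sum in \<open>simp_all add: M W_def\<close>)
  moreover have "closed W"
    unfolding W_def
    by (rule closed_range_of_complementary_ranges[OF R NL S(1) subspace_UNIV])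
      (use disj sum in \<open>simp_all add: M W_def Int_commute add.commute\<close>)
  ultimately show ?thesis
    unfolding topologically_complemented_def using subM subW disj sum by blast
qed

end
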